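(* Let $m,n,K,L\ge 1$, let $(h_l)_{l=0}^{L-1}$ be a frame of $\mathbb{C}^n$ and $(g_k)_{k=0}^{K-1}$ a frame of $\mathbb{C}^m$, and let $T:\mathbb{C}^n\to\mathbb{C}^m$ be a linear operator, identified with its $m\times n$ matrix. Then for all $0\le k<K$, $0\le l<L$: 1. $\langle T,g_k\otimes\overline{h}_l\rangle_{\mathcal{HS}}=\left\langle \mathrm{vec}^{(m)}(T),\mathrm{vec}^{(m)}(g_k\otimes\overline{h}_l)\right\rangle_{\mathbb{C}^{mn}}$, and evaluating this expression has complexity in $\mathcal{O}(3mn+m-1)$ for each single pair $(l,k)$. 2. $\langle T,g_k\otimes\overline{h}_l\rangle_{\mathcal{HS}}=\langle Th_l,g_k\rangle_{\mathbb{C}^m}$, and evaluating this expression has complexity in $\mathcal{O}(2mn+m-1)$ for each single pair $(l,k)$. 3. $\langle T,g_k\otimes\overline{h}_l\rangle_{\mathcal{HS}}=(C_g\,T\,D_h)_{k,l}$, and evaluating this (computing first $TD_h$, then $C_g(TD_h)$) has complexity in $\mathcal{O}\big(L(2mn-m+2mK-K)\big)$ for all pairs $(l,k)$ together. 4. $\langle T,g_k\otimes\overline{h}_l\rangle_{\mathcal{HS}}=\left(\left(D_h^{T}\otimes C_g\right)\mathrm{vec}^{(m)}(T)\right)_{k+lK}$, where $\otimes$ is the Kronecker product, and evaluating this has complexity in $\mathcal{O}\big(KL(3mn-1)\big)$ for all pairs $(l,k)$ together.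
   Context: Inner products on $\mathbb{C}^p$ are linear in the first argument; matrix and vector indices start at $0$. A frame of $\mathbb{C}^p$ is a sequence $(x_k)$ with $A\|x\|^2\le\sum_k|\langle x,x_k\rangle|^2\le B\|x\|^2$ for all $x$, for some $A,B>0$. $g\otimes\overline{h}$ denotes the operator $x\mapsto\langle x,h\rangle g$, with matrix entries $g_i\overline{h_j}$. $\langle A,B\rangle_{\mathcal{HS}}=\sum_{i,j}A_{i,j}\overline{B_{i,j}}$. $D_h$ is the $n\times L$ synthesis matrix whose columns are $h_0,\dots,h_{L-1}$; $C_g$ is the $K\times m$ analysis matrix whose rows are the conjugate transposes of $g_0,\dots,g_{K-1}$. For a matrix $M$ with $q$ rows, $\mathrm{vec}^{(q)}(M)_j=M_{j\bmod q,\lfloor j/q\rfloor}$ (stacking the columns). The Kronecker product of a $p\times q$ matrix $A$ and an $r\times s$ matrix $B$ is the $pr\times qs$ matrix with entries $(A\otimes B)_{i,j}=A_{\lfloor i/r\rfloor,\lfloor j/s\rfloor}B_{i\bmod r,\,j\bmod s}$. Complexity: "$\in\mathcal{O}(N)$" means that the number of elementary scalar operations used by the direct evaluation of the expression is of order $N$. The costs are: an inner product in $\mathbb{C}^p$ costs $2p-1$; a $p\times q$ matrix times a vector costs $p(2q-1)$; a $p\times q$ matrix times a $q\times r$ matrix costs $pr(2q-1)$; the Kronecker product of a $p\times q$ and an $r\times s$ matrix costs $pqrs$ (in particular the outer product $g_k\otimes\overline{h}_l$ costs $mn$ multiplications, plus complex conjugation costing one operation per conjugated vector entry); reordering entries (such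 as $\mathrm{vec}$) is free. *)

theory Defs
  imports "Jordan_Normal_Form.Matrix" "HOL-Library.Landau_Symbols"
begin

text \<open>
  Vectors and matrices over the complex numbers are those of the Jordan normal form library, with
  dimensions carried by the values and indices starting at 0. The inner product of \<open>x\<close> and \<open>y\<close>
  is \<open>x \<bullet>c y\<close>, linear in \<open>x\<close>. A linear operator from the \<open>n\<close>-dimensional to the
  \<open>m\<close>-dimensional space is an element of \<open>carrier_mat m n\<close>. A finite sequence of \<open>N\<close> vectors
  is a function on the natural numbers of which only the values below \<open>N\<close> matter.
\<close>

definition sq_norm_cvec :: "complex vec \<Rightarrow> real" where
  "sq_norm_cvec x = (\<Sum>i<dim_vec x. (cmod (x $ i))\<^sup>2)"

definition is_frame :: "nat \<Rightarrow> nat \<Rightarrow> (nat \<Rightarrow> complex vec) \<Rightarrow> bool" where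
  "is_frame p N x \<longleftrightarrow>
     (\<forall>k<N. x k \<in> carrier_vec p) \<and>
     (\<exists>A B :: real. 0 < A \<and> 0 < B \<and>
        (\<forall>v\<in>carrier_vec p.
           A * sq_norm_cvec v \<le> (\<Sum>k<N. (cmod (v \<bullet>c x k))\<^sup>2) \<and>
           (\<Sum>k<N. (cmod (v \<bullet>c x k))\<^sup>2) \<le> B * sq_norm_cvec v))"

definition synthesis_mat :: "nat \<Rightarrow> nat \<Rightarrow> (nat \<Rightarrow> complex vec) \<Rightarrow> complex mat" where
  "synthesis_mat n L h = mat_of_cols n (map h [0..<L])"

definition analysis_mat :: "nat \<Rightarrow> nat \<Rightarrow> (nat \<Rightarrow> complex vec) \<Rightarrow> complex mat" where
  "analysis_mat m K g = mat_of_rows m (map (\<lambda>k. conjugate (g k)) [0..<K])"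

text \<open>The matrix of the rank one operator mapping \<open>x\<close> to \<open>(x \<bullet>c h) \<cdot>\<^sub>v g\<close>; the conjugation
  of \<open>h\<close> is part of the definition.\<close>

definition outer :: "complex vec \<Rightarrow> complex vec \<Rightarrow> complex mat" where
  "outer g h = mat (dim_vec g) (dim_vec h) (\<lambda>(i, j). g $ i * cnj (h $ j))"

lemma outer_mult_vec:
  assumes "g \<in> carrier_vec m" "h \<in> carrier_vec n" "x \<in> carrier_vec n"
  shows "outer g h *\<^sub>v x = (x \<bullet>c h) \<cdot>\<^sub>v g"
  using assms by (intro eq_vecI) (auto simp: outer_def scalar_prod_def sum_distrib_left mult_ac)

definition hs_inner :: "complex mat \<Rightarrow> complex mat \<Rightarrow> complex" where
  "hs_inner A B = (\<Sum>i<dim_row A. \<Sum>j<dim_col A. A $$ (i, j) * cnj (B $$ (i, j)))"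

definition vectorize :: "complex mat \<Rightarrow> complex vec" where
  "vectorize M = vec (dim_row M * dim_col M) (\<lambda>j. M $$ (j mod dim_row M, j div dim_row M))"

definition kronecker :: "complex mat \<Rightarrow> complex mat \<Rightarrow> complex mat" where
  "kronecker A B = mat (dim_row A * dim_row B) (dim_col A * dim_col B)
     (\<lambda>(i, j). A $$ (i div dim_row B, j div dim_col B) * B $$ (i mod dim_row B, j mod dim_col B))"

text \<open>
  To speak about the number of scalar operations used by the direct evaluation of an expression,
  expressions are represented by syntax trees, with a value and an operation count. The leaves
  \<open>VConst\<close> and \<open>MConst\<close> are given input data and cost nothing.
\<close>

datatype vexpr = VConst "complex vec" | MVMult mexpr vexpr | Vectorize mexpr
  and mexpr = MConst "complex mat" | MMult mexpr mexpr | Outer vexpr vexpr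
    | Kronecker mexpr mexpr | Transpose mexpr

datatype sexpr = Inner vexpr vexpr

primrec vvalue :: "vexpr \<Rightarrow> complex vec" and mvalue :: "mexpr \<Rightarrow> complex mat" where
  "vvalue (VConst x) = x"
| "vvalue (MVMult a x) = mvalue a *\<^sub>v vvalue x"
| "vvalue (Vectorize a) = vectorize (mvalue a)"
| "mvalue (MConst A) = A"
| "mvalue (MMult a b) = mvalue a * mvalue b"
| "mvalue (Outer x y) = outer (vvalue x) (vvalue y)"
| "mvalue (Kronecker a b) = kronecker (mvalue a) (mvalue b)"
| "mvalue (Transpose a) = transpose_mat (mvalue a)"

primrec svalue :: "sexpr \<Rightarrow> complex" where
  "svalue (Inner x y) = vvalue x \<bullet>c vvalue y"

text \<open>
  In the \<open>Outer\<close> case the last summand counts the conjugation of the second vector. Vectorization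
  and transposition only reorder entries and are free. All inner dimensions are positive in the
  intended use, so the subtractions on the natural numbers do not truncate.
\<close>

primrec vops :: "vexpr \<Rightarrow> nat" and mops :: "mexpr \<Rightarrow> nat" where
  "vops (VConst x) = 0"
| "vops (MVMult a x) = mops a + vops x + dim_row (mvalue a) * (2 * dim_col (mvalue a) - 1)"
| "vops (Vectorize a) = mops a"
| "mops (MConst A) = 0"
| "mops (MMult a b) = mops a + mops b +
     dim_row (mvalue a) * dim_col (mvalue b) * (2 * dim_col (mvalue a) - 1)"
| "mops (Outer x y) = vops x + vops y +
     dim_vec (vvalue x) * dim_vec (vvalue y) + dim_vec (vvalue y)"
| "mops (Kronecker a b) = mops a + mops b +
     dim_row (mvalue a) * dim_col (mvalue a) * dim_row (mvalue b) * dim_col (mvalue b)"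
| "mops (Transpose a) = mops a"

primrec sops :: "sexpr \<Rightarrow> nat" where
  "sops (Inner x y) = vops x + vops y + (2 * dim_vec (vvalue x) - 1)"

text \<open>The four ways of evaluating the inner products. The last two evaluate all pairs at once.\<close>

definition vec_inner_expr :: "complex mat \<Rightarrow> complex vec \<Rightarrow> complex vec \<Rightarrow> sexpr" where
  "vec_inner_expr T g h =
     Inner (Vectorize (MConst T)) (Vectorize (Outer (VConst g) (VConst h)))"

definition apply_inner_expr :: "complex mat \<Rightarrow> complex vec \<Rightarrow> complex vec \<Rightarrow> sexpr" where
  "apply_inner_expr T g h = Inner (MVMult (MConst T) (VConst h)) (VConst g)"

definition mat_prod_expr :: "complex mat \<Rightarrow> complex mat \<Rightarrow> complex mat \<Rightarrow> mexpr" where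
  "mat_prod_expr C T D = MMult (MConst C) (MMult (MConst T) (MConst D))"

definition kronecker_expr :: "complex mat \<Rightarrow> complex mat \<Rightarrow> complex mat \<Rightarrow> vexpr" where
  "kronecker_expr C T D =
     MVMult (Kronecker (Transpose (MConst D)) (MConst C)) (Vectorize (MConst T))"

type_synonym instance_data =
  "nat \<times> nat \<times> nat \<times> nat \<times> (nat \<Rightarrow> complex vec) \<times> (nat \<Rightarrow> complex vec) \<times> complex mat"

definition setting :: "instance_data set" where
  "setting = {(m, n, K, L, h, g, T).
     1 \<le> m \<and> 1 \<le> n \<and> 1 \<le> K \<and> 1 \<le> L \<and>
     is_frame n L h \<and> is_frame m K g \<and> T \<in> carrier_mat m n}"

text \<open>An instance together with a pair of indices \<open>k\<close> and \<open>l\<close>.\<close>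

definition pair_setting :: "(instance_data \<times> nat \<times> nat) set" where
  "pair_setting = {((m, n, K, L, h, g, T), k, l).
     (m, n, K, L, h, g, T) \<in> setting \<and> k < K \<and> l < L}"

text \<open>
  \<open>f\<close> is of order \<open>N\<close> on \<open>S\<close>: there are positive constants, independent of the point of \<open>S\<close>
  (so of all dimensions and data), that bound \<open>f\<close> above and below by multiples of \<open>N\<close>. In
  particular \<open>f \<in> O[principal S](N)\<close>.
\<close>

definition of_order_on :: "'a set \<Rightarrow> ('a \<Rightarrow> nat) \<Rightarrow> ('a \<Rightarrow> real) \<Rightarrow> bool" where
  "of_order_on S f N \<longleftrightarrow> (\<lambda>x. real (f x)) \<in> \<Theta>[principal S](N)"

end

theory Submission
  imports Defs
begin

text \<open>All four expressions are arrangements of one double sum, over i and j, of T_ij h_j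
  conj(g_i), where h is h_l and g is g_k. Reading the index pairs column by column gives the
  vectorized inner product. Summing over j first gives the coordinates of T h_l, hence the pairing
  with g_k and also the (k, l) entry of the triple product. Row k + l K of the Kronecker matrix
  holds the coefficients h_j conj(g_i) in column-major order. The carrying facts are the reindexing
  \<open>sum_mod_div\<close> and the expansion \<open>hs_inner_outer\<close>. For the complexities,
  each operation count is computed in closed form. Three counts equal the stated expression exactly;
  the first differs from it only by n in place of m and is compared with explicit constants.\<close>

text \<open>Column-major enumeration of an m by n grid is a bijection: q goes to (q mod m, q div m),
  with inverse i + j m.\<close>

lemma sum_mod_div:
  fixes f :: "nat \<Rightarrow> nat \<Rightarrow> 'a :: comm_monoid_add"
  shows "(\<Sum>q<m * n. f (q mod m) (q div m)) = (\<Sum>i<m. \<Sum>j<n. f i j)"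
proof -
  have "(\<Sum>i<m. \<Sum>j<n. f i j) = (\<Sum>(i, j)\<in>{..<m} \<times> {..<n}. f i j)"
    by (simp add: sum.cartesian_product)
  also have "\<dots> = (\<Sum>q<m * n. f (q mod m) (q div m))"
  proof (rule sum.reindex_bij_witness[where i = "\<lambda>q. (q mod m, q div m)" and j = "\<lambda>(i, j). i + j * m"])
    fix q assume q: "q \<in> {..<m * n}"
    then have "0 < m" by (cases m) auto
    with q show "(q mod m, q div m) \<in> {..<m} \<times> {..<n}"
      by (auto simp: less_mult_imp_div_less mult.commute)
  next
    fix p assume p: "p \<in> {..<m} \<times> {..<n}"
    then obtain i j where ij: "p = (i, j)" "i < m" "j < n" by auto
    have "i + j * m < m + j * m" using ij by simp
    also have "\<dots> = Suc j * m" by simp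
    also have "\<dots> \<le> n * m" using ij by (intro mult_le_mono1) simp
    finally show "(case p of (i, j) \<Rightarrow> i + j * m) \<in> {..<m * n}"
      using ij by (simp add: mult.commute)
  qed auto
  finally show ?thesis ..
qed

text \<open>Conjugating g_i conj(h_j) moves the conjugation from h to g. This is the common form to
  which the last three expressions are reduced.\<close>

lemma hs_inner_outer:
  assumes "T \<in> carrier_mat m n"
    and "g \<in> carrier_vec m" and "h \<in> carrier_vec n"
  shows "hs_inner T (outer g h) = (\<Sum>i<m. \<Sum>j<n. T $$ (i, j) * h $ j * cnj (g $ i))"
  using assms by (auto simp: hs_inner_def outer_def mult_ac intro!: sum.cong)

text \<open>Both matrices are listed in the same column-major order, so corresponding entries still
  meet and only the order of summation changes.\<close>

lemma hs_inner_eq_vectorize: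
  assumes "A \<in> carrier_mat m n" and "B \<in> carrier_mat m n"
  shows "hs_inner A B = vectorize A \<bullet>c vectorize B"
proof -
  have "vectorize A \<bullet>c vectorize B =
      (\<Sum>q<m * n. A $$ (q mod m, q div m) * cnj (B $$ (q mod m, q div m)))"
    using assms by (auto simp: scalar_prod_def vectorize_def atLeast0LessThan intro!: sum.cong)
  also have "\<dots> = hs_inner A B"
    using assms by (simp add: sum_mod_div[of "\<lambda>i j. A $$ (i, j) * cnj (B $$ (i, j))"] hs_inner_def)
  finally show ?thesis ..
qed

text \<open>For fixed i the factor conj(g_i) leaves the sum over j, and what remains is coordinate i
  of T h.\<close>

lemma hs_inner_outer_eq_apply:
  assumes "T \<in> carrier_mat m n"
    and "g \<in> carrier_vec m" and "h \<in> carrier_vec n"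
  shows "hs_inner T (outer g h) = (T *\<^sub>v h) \<bullet>c g"
  using assms unfolding hs_inner_outer[OF assms]
  by (auto simp: scalar_prod_def sum_distrib_right atLeast0LessThan intro!: sum.cong)

lemma synthesis_mat_carrier [simp]: "synthesis_mat n L h \<in> carrier_mat n L"
  by (auto simp: synthesis_mat_def mat_of_cols_def)

lemma analysis_mat_carrier [simp]: "analysis_mat m K g \<in> carrier_mat K m"
  by (auto simp: analysis_mat_def mat_of_rows_def)

lemma synthesis_mat_dims [simp]:
  "dim_row (synthesis_mat n L h) = n" "dim_col (synthesis_mat n L h) = L"
  by (auto simp: synthesis_mat_def)

lemma analysis_mat_dims [simp]:
  "dim_row (analysis_mat m K g) = K" "dim_col (analysis_mat m K g) = m"
  by (auto simp: analysis_mat_def)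

lemma synthesis_mat_index [simp]:
  "i < n \<Longrightarrow> l < L \<Longrightarrow> synthesis_mat n L h $$ (i, l) = h l $ i"
  by (simp add: synthesis_mat_def mat_of_cols_index)

lemma analysis_mat_index [simp]:
  "k < K \<Longrightarrow> i < m \<Longrightarrow> g k \<in> carrier_vec m \<Longrightarrow> analysis_mat m K g $$ (k, i) = cnj (g k $ i)"
  by (simp add: analysis_mat_def mat_of_rows_index)

lemma hs_inner_outer_eq_mat_prod:
  assumes T: "T \<in> carrier_mat m n"
    and g: "g k \<in> carrier_vec m" and h: "h l \<in> carrier_vec n"
    and kl: "k < K" "l < L"
  shows "hs_inner T (outer (g k) (h l)) = (analysis_mat m K g * T * synthesis_mat n L h) $$ (k, l)"
proof -
  \<comment> \<open>With this bracketing, column l of the right factor is T h_l and row k of the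
    left one is the conjugate of g_k. Associativity restores the stated form at the end.\<close>
  have "(analysis_mat m K g * (T * synthesis_mat n L h)) $$ (k, l) =
      (\<Sum>i<m. cnj (g k $ i) * (\<Sum>j<n. T $$ (i, j) * h l $ j))"
    using assms by (simp add: scalar_prod_def atLeast0LessThan)
  also have "\<dots> = hs_inner T (outer (g k) (h l))"
    unfolding hs_inner_outer[OF T g h] by (simp add: sum_distrib_left mult_ac)
  finally show ?thesis
    using T by (simp add: assoc_mult_mat[of _ K m _ n _ L])
qed

text \<open>Since k < K, the row index k + l K has quotient l and remainder k modulo K. Splitting
  the column index q modulo m in the same way makes the matrix entry h_l(q div m) conj(g_k(q mod
  m)), matched with the entry of T at (q mod m, q div m).\<close>

lemma hs_inner_outer_eq_kronecker:
  assumes T: "T \<in> carrier_mat m n"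
    and g: "g k \<in> carrier_vec m" and h: "h l \<in> carrier_vec n"
    and kl: "k < K" "l < L"
  shows "hs_inner T (outer (g k) (h l)) =
    (kronecker (transpose_mat (synthesis_mat n L h)) (analysis_mat m K g) *\<^sub>v vectorize T)
      $ (k + l * K)"
proof -
  \<comment> \<open>The row index must be in range before the entry of the product can be
    unfolded.\<close>
  have "k + l * K < K + l * K" using kl by simp
  also have "\<dots> = Suc l * K" by simp
  also have "\<dots> \<le> L * K" using kl by (intro mult_le_mono1) simp
  finally have r: "k + l * K < L * K" .
  have "(kronecker (transpose_mat (synthesis_mat n L h)) (analysis_mat m K g) *\<^sub>v vectorize T)
      $ (k + l * K) =
      (\<Sum>q<m * n. h l $ (q div m) * cnj (g k $ (q mod m)) * T $$ (q mod m, q div m))"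
  proof -
    have q: "q div m < n" "q mod m < m" if "q < m * n" for q
      using that by (auto simp: less_mult_imp_div_less mult.commute intro!: mod_less_divisor gr0I)
    show ?thesis
      using assms r q
      by (auto simp: kronecker_def scalar_prod_def vectorize_def atLeast0LessThan mult.commute[of n m]
          intro!: sum.cong)
  qed
  also have "\<dots> = hs_inner T (outer (g k) (h l))"
    unfolding hs_inner_outer[OF T g h]
      sum_mod_div[of "\<lambda>i j. h l $ j * cnj (g k $ i) * T $$ (i, j)"]
    by (simp add: mult_ac)
  finally show ?thesis ..
qed

text \<open>The summands are the outer product, the conjugation of the n entries of h, and an inner
  product of length mn.\<close>

lemma sops_vec_inner_expr:
  assumes "T \<in> carrier_mat m n"
    and "g \<in> carrier_vec m" and "h \<in> carrier_vec n"
  shows "sops (vec_inner_expr T g h) = m * n + n + (2 * (m * n) - 1)"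
  using assms by (simp add: vec_inner_expr_def vectorize_def)

lemma sops_apply_inner_expr:
  assumes "T \<in> carrier_mat m n"
  shows "sops (apply_inner_expr T g h) = m * (2 * n - 1) + (2 * m - 1)"
  using assms by (simp add: apply_inner_expr_def)

lemma mops_mat_prod_expr:
  assumes "C \<in> carrier_mat K m" "T \<in> carrier_mat m n" "D \<in> carrier_mat n L"
  shows "mops (mat_prod_expr C T D) = m * L * (2 * n - 1) + K * L * (2 * m - 1)"
  using assms by (simp add: mat_prod_expr_def)

lemma vops_kronecker_expr:
  assumes "C \<in> carrier_mat K m" "D \<in> carrier_mat n L"
  shows "vops (kronecker_expr C T D) = L * n * K * m + L * K * (2 * (n * m) - 1)"
  using assms by (simp add: kronecker_expr_def kronecker_def)

text \<open>For a principal filter, "eventually" means "everywhere on S", so pointwise equality on S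
  already gives the same order.\<close>

lemma of_order_on_eqI:
  assumes "\<And>x. x \<in> S \<Longrightarrow> real (f x) = N x"
  shows "of_order_on S f N"
  unfolding of_order_on_def
  by (rule bigthetaI_cong) (simp add: eventually_principal assms)

lemma of_order_onI:
  assumes "0 < a" "0 < b"
    and "\<And>x. x \<in> S \<Longrightarrow> a * \<bar>N x\<bar> \<le> real (f x)"
    and "\<And>x. x \<in> S \<Longrightarrow> real (f x) \<le> b * \<bar>N x\<bar>"
  shows "of_order_on S f N"
  unfolding of_order_on_def
  by (rule bigthetaI'[OF assms(1,2)]) (simp add: eventually_principal assms(3,4))

lemma settingD:
  assumes "(m, n, K, L, h, g, T) \<in> setting"
  shows "1 \<le> m" "1 \<le> n" "1 \<le> K" "1 \<le> L" "T \<in> carrier_mat m n"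
    and "k < K \<Longrightarrow> g k \<in> carrier_vec m" and "l < L \<Longrightarrow> h l \<in> carrier_vec n"
  using assms by (auto simp: setting_def is_frame_def)

lemma pair_settingD:
  assumes "((m, n, K, L, h, g, T), k, l) \<in> pair_setting"
  shows "1 \<le> m" "1 \<le> n" "k < K" "l < L"
    and "T \<in> carrier_mat m n" "g k \<in> carrier_vec m" "h l \<in> carrier_vec n"
  using assms settingD[of m n K L h g T] by (auto simp: pair_setting_def)

lemma outer_carrier:
  "g \<in> carrier_vec m \<Longrightarrow> h \<in> carrier_vec n \<Longrightarrow> outer g h \<in> carrier_mat m n"
  by (auto simp: outer_def)

text \<open>Evaluating the first expression takes exactly \<open>3mn + n - 1\<close> operations, which lies between
  half and twice the stated \<open>3mn + m - 1\<close>; the other three counts agree with the stated ones.\<close>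

lemma vec_inner_order:
  "of_order_on pair_setting
     (\<lambda>((m, n, K, L, h, g, T), k, l). sops (vec_inner_expr T (g k) (h l)))
     (\<lambda>((m, n, K, L, h, g, T), k, l). 3 * real m * real n + real m - 1)"
proof (rule of_order_onI[of "1/2" 2]; clarify?)
  fix m n K L :: nat and h g :: "nat \<Rightarrow> complex vec" and T k l
  assume "((m, n, K, L, h, g, T), k, l) \<in> pair_setting"
  note D = pair_settingD[OF this]
  \<comment> \<open>With mn treated as a single unknown these facts are linear, and they place both
    3mn + m - 1 and 3mn + n - 1 between 3mn and 4mn.\<close>
  have mn: "real m \<le> real m * real n" "real n \<le> real m * real n" "1 \<le> real m" "1 \<le> real n"
    using D(1,2) by simp_all
  have c: "real (sops (vec_inner_expr T (g k) (h l))) = 3 * real m * real n + real n - 1"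
    using D(1,2) unfolding sops_vec_inner_expr[OF D(5,6,7)] by (simp add: of_nat_diff)
  show "1 / 2 * \<bar>3 * real m * real n + real m - 1\<bar> \<le> real (sops (vec_inner_expr T (g k) (h l)))"
    using mn unfolding c mult.assoc by argo
  show "real (sops (vec_inner_expr T (g k) (h l))) \<le> 2 * \<bar>3 * real m * real n + real m - 1\<bar>"
    using mn unfolding c mult.assoc by argo
qed simp_all

lemma apply_inner_order:
  "of_order_on pair_setting
     (\<lambda>((m, n, K, L, h, g, T), k, l). sops (apply_inner_expr T (g k) (h l)))
     (\<lambda>((m, n, K, L, h, g, T), k, l). 2 * real m * real n + real m - 1)"
proof (rule of_order_on_eqI; clarify)
  fix m n K L :: nat and h g :: "nat \<Rightarrow> complex vec" and T k l
  assume "((m, n, K, L, h, g, T), k, l) \<in> pair_setting"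
  note D = pair_settingD[OF this]
  show "real (sops (apply_inner_expr T (g k) (h l))) = 2 * real m * real n + real m - 1"
    using D(1,2) unfolding sops_apply_inner_expr[OF D(5)]
    by (simp add: of_nat_diff algebra_simps)
qed

lemma mat_prod_order:
  "of_order_on setting
     (\<lambda>(m, n, K, L, h, g, T). mops (mat_prod_expr (analysis_mat m K g) T (synthesis_mat n L h)))
     (\<lambda>(m, n, K, L, h, g, T).
        real L * (2 * real m * real n - real m + 2 * real m * real K - real K))"
proof (rule of_order_on_eqI; clarify)
  fix m n K L :: nat and h g :: "nat \<Rightarrow> complex vec" and T
  assume "(m, n, K, L, h, g, T) \<in> setting"
  note D = settingD[OF this]
  \<comment> \<open>Positivity of m and n keeps the natural subtractions from truncating.\<close>
  have pred: "real (2 * m - 1) = 2 * real m - 1" "real (2 * n - 1) = 2 * real n - 1"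
    using D(1,2) by (simp_all add: of_nat_diff)
  show "real (mops (mat_prod_expr (analysis_mat m K g) T (synthesis_mat n L h))) =
      real L * (2 * real m * real n - real m + 2 * real m * real K - real K)"
    unfolding mops_mat_prod_expr[OF analysis_mat_carrier D(5) synthesis_mat_carrier]
      of_nat_add of_nat_mult pred
    by (simp add: algebra_simps)
qed

lemma kronecker_order:
  "of_order_on setting
     (\<lambda>(m, n, K, L, h, g, T). vops (kronecker_expr (analysis_mat m K g) T (synthesis_mat n L h)))
     (\<lambda>(m, n, K, L, h, g, T). real K * real L * (3 * real m * real n - 1))"
proof (rule of_order_on_eqI; clarify)
  fix m n K L :: nat and h g :: "nat \<Rightarrow> complex vec" and T
  assume "(m, n, K, L, h, g, T) \<in> setting"
  note D = settingD[OF this]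
  show "real (vops (kronecker_expr (analysis_mat m K g) T (synthesis_mat n L h))) =
      real K * real L * (3 * real m * real n - 1)"
    using D(1,2)
    unfolding vops_kronecker_expr[OF analysis_mat_carrier synthesis_mat_carrier]
    by (simp add: of_nat_diff algebra_simps)
qed

theorem theorem4p5:
  shows "(\<forall>((m, n, K, L, h, g, T), k, l) \<in> pair_setting.
            hs_inner T (outer (g k) (h l)) = vectorize T \<bullet>c vectorize (outer (g k) (h l)) \<and>
            svalue (vec_inner_expr T (g k) (h l)) = vectorize T \<bullet>c vectorize (outer (g k) (h l))) \<and>
     (of_order_on pair_setting
            (\<lambda>((m, n, K, L, h, g, T), k, l). sops (vec_inner_expr T (g k) (h l)))
            (\<lambda>((m, n, K, L, h, g, T), k, l). 3 * real m * real n + real m - 1)) \<and>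
     (\<forall>((m, n, K, L, h, g, T), k, l) \<in> pair_setting.
            hs_inner T (outer (g k) (h l)) = (T *\<^sub>v h l) \<bullet>c g k \<and>
            svalue (apply_inner_expr T (g k) (h l)) = (T *\<^sub>v h l) \<bullet>c g k) \<and>
     (of_order_on pair_setting
            (\<lambda>((m, n, K, L, h, g, T), k, l). sops (apply_inner_expr T (g k) (h l)))
            (\<lambda>((m, n, K, L, h, g, T), k, l). 2 * real m * real n + real m - 1)) \<and>
     (\<forall>((m, n, K, L, h, g, T), k, l) \<in> pair_setting.
            hs_inner T (outer (g k) (h l)) =
              (analysis_mat m K g * T * synthesis_mat n L h) $$ (k, l) \<and>
            mvalue (mat_prod_expr (analysis_mat m K g) T (synthesis_mat n L h)) =
              analysis_mat m K g * T * synthesis_mat n L h) \<and>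
     (of_order_on setting
            (\<lambda>(m, n, K, L, h, g, T).
               mops (mat_prod_expr (analysis_mat m K g) T (synthesis_mat n L h)))
            (\<lambda>(m, n, K, L, h, g, T).
               real L * (2 * real m * real n - real m + 2 * real m * real K - real K))) \<and>
     (\<forall>((m, n, K, L, h, g, T), k, l) \<in> pair_setting.
            hs_inner T (outer (g k) (h l)) =
              (kronecker (transpose_mat (synthesis_mat n L h)) (analysis_mat m K g)
                 *\<^sub>v vectorize T) $ (k + l * K) \<and>
            vvalue (kronecker_expr (analysis_mat m K g) T (synthesis_mat n L h)) =
              kronecker (transpose_mat (synthesis_mat n L h)) (analysis_mat m K g) *\<^sub>v vectorize T) \<and>
     (of_order_on setting
            (\<lambda>(m, n, K, L, h, g, T).
               vops (kronecker_expr (analysis_mat m K g) T (synthesis_mat n L h)))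
            (\<lambda>(m, n, K, L, h, g, T). real K * real L * (3 * real m * real n - 1)))"
proof (intro conjI vec_inner_order apply_inner_order mat_prod_order kronecker_order; clarify;
    intro conjI)
  fix m n K L :: nat and h g :: "nat \<Rightarrow> complex vec" and T k l
  assume "((m, n, K, L, h, g, T), k, l) \<in> pair_setting"
  note D = pair_settingD[OF this]
  show "hs_inner T (outer (g k) (h l)) = vectorize T \<bullet>c vectorize (outer (g k) (h l))"
    by (rule hs_inner_eq_vectorize[OF D(5) outer_carrier[OF D(6,7)]])
  show "hs_inner T (outer (g k) (h l)) = (T *\<^sub>v h l) \<bullet>c g k"
    by (rule hs_inner_outer_eq_apply[OF D(5-7)])
  show "hs_inner T (outer (g k) (h l)) =
      (analysis_mat m K g * T * synthesis_mat n L h) $$ (k, l)"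
    by (rule hs_inner_outer_eq_mat_prod[where g = g and h = h, OF D(5-7) D(3,4)])
  \<comment> \<open>The syntax tree multiplies T by the synthesis matrix first, so its value has the
    other bracketing.\<close>
  show "mvalue (mat_prod_expr (analysis_mat m K g) T (synthesis_mat n L h)) =
      analysis_mat m K g * T * synthesis_mat n L h"
    using D(5) by (simp add: mat_prod_expr_def assoc_mult_mat[of _ K m _ n _ L])
  show "hs_inner T (outer (g k) (h l)) =
      (kronecker (transpose_mat (synthesis_mat n L h)) (analysis_mat m K g) *\<^sub>v vectorize T)
        $ (k + l * K)"
    by (rule hs_inner_outer_eq_kronecker[where g = g and h = h, OF D(5-7) D(3,4)])
\<comment> \<open>The value equations of the other three syntax trees hold by unfolding.\<close>
qed (simp_all add: vec_inner_expr_def apply_inner_expr_def kronecker_expr_def)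

end
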